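(* Let $d\ge 1$, let $\mathcal{P}=(P_i)_{i\ge 0}$ be a probability distribution on $\{0,1,2,\dots\}$, and for $x\in\mathbb{Z}^d$ let $(\beta_t^x)_{t\ge 0}$ be the aperiodic nearest-neighbors branching random walk on $\mathbb{Z}^d$ with offspring distribution $\mathcal{P}$ initiated by a single particle at $x$. For $n\ge 1$ and $x\in\mathring{\Lambda}_n^d$ let $$\tau_n^x=\inf\{t:\ \beta_t^x(z)\ge 1\text{ for some } z\in\partial\Lambda_n^d\},\qquad p_n(x)=\mathbb{P}(\tau_n^x<\infty).$$ Then for all $n\ge 1$ and all $x,y\in\mathbb{Z}_+^d\cap\mathring{\Lambda}_n^d$, $$x\preceq y\ \Longrightarrow\ \tau_n^y\le_{st.}\tau_n^x,$$ and, in particular, $p_n(x)\le p_n(y)$.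
   Context: Aperiodic nearest-neighbors branching random walk with offspring distribution $\mathcal{P}$: the discrete-time particle system on $\mathbb{Z}^d$ in which every particle, independently of the other particles, generates a random number of offspring distributed according to $\mathcal{P}$ and dies after one time unit; each offspring particle is placed (independently) at a site chosen uniformly at random from the $2d+1$ sites at ($L^1$-)distance at most $1$ from the location of the parent (the parent's site and its $2d$ neighbors). $\beta_t(z)$ is the number of particles at site $z$ at time $t\in\{0,1,2,\dots\}$. Notation: $\|x\|=\max_i|x_i|$; $\Lambda_n^d=\{x\in\mathbb{Z}^d:\|x\|\le n\}$; $\partial\Lambda_n^d=\{x\in\Lambda_n^d:\|x\|=n\}$; $\mathring{\Lambda}_n^d=\Lambda_n^d\setminus\partial\Lambda_n^d$. $\mathbb{Z}_+^d$ is the set of points of $\mathbb{Z}^d$ with all coordinates $\ge 0$. For $x,y\in\mathbb{Z}_+^d$, $x\preceq y$ means $x_i\le y_i$ for all $i=1,\dots,d$. For random variables $X,Y$ with cumulative distribution functions $F,G$, $X\le_{st.}Y$ means $F(s)\ge G(s)$ for all $s$. Convention: $\inf\emptyset=\infty$. *)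

theory Defs
  imports "HOL-Probability.Probability" "HOL-Library.Extended_Nat"
begin

definition sup_norm :: "int ^ 'd \<Rightarrow> int" where
  "sup_norm x = Max (range (\<lambda>i. \<bar>x $ i\<bar>))"

definition lattice_box :: "nat \<Rightarrow> (int ^ 'd) set" where
  "lattice_box n = {x. sup_norm x \<le> int n}"

definition box_boundary :: "nat \<Rightarrow> (int ^ 'd) set" where
  "box_boundary n = {x \<in> lattice_box n. sup_norm x = int n}"

definition box_interior :: "nat \<Rightarrow> (int ^ 'd) set" where
  "box_interior n = lattice_box n - box_boundary n"

definition nonneg_orthant :: "(int ^ 'd) set" where
  "nonneg_orthant = {x. \<forall>i. 0 \<le> x $ i}"

definition nbhd :: "int ^ 'd \<Rightarrow> (int ^ 'd) set" where
  "nbhd z = {w. (\<Sum>i\<in>UNIV. \<bar>w $ i - z $ i\<bar>) \<le> 1}"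

lemma nbhd_eq:
  "nbhd (z :: int ^ 'd) = insert z ((\<lambda>(i, s). z + axis i s) ` (UNIV \<times> {-1, 1}))" (is "_ = ?R")
proof (intro equalityI subsetI)
  fix w assume w: "w \<in> nbhd z"
  show "w \<in> ?R"
  proof (cases "w = z")
    case False
    then obtain i where i: "w $ i \<noteq> z $ i"
      by (auto simp: vec_eq_iff)
    have "(\<Sum>j\<in>UNIV. \<bar>w $ j - z $ j\<bar>) = \<bar>w $ i - z $ i\<bar> + (\<Sum>j\<in>UNIV - {i}. \<bar>w $ j - z $ j\<bar>)"
      by (simp add: sum.remove)
    moreover have "(\<Sum>j\<in>UNIV - {i}. \<bar>w $ j - z $ j\<bar>) \<ge> 0"
      by (simp add: sum_nonneg)
    moreover have "(\<Sum>j\<in>UNIV. \<bar>w $ j - z $ j\<bar>) \<le> 1"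
      using w by (simp add: nbhd_def)
    moreover have "\<bar>w $ i - z $ i\<bar> \<ge> 1"
      using i by linarith
    ultimately have le: "\<bar>w $ i - z $ i\<bar> = 1" and "(\<Sum>j\<in>UNIV - {i}. \<bar>w $ j - z $ j\<bar>) = 0"
      by linarith+
    then have "\<forall>j. j \<noteq> i \<longrightarrow> w $ j = z $ j"
      by (subst (asm) sum_nonneg_eq_0_iff) auto
    then have "w = z + axis i (w $ i - z $ i)"
      by (auto simp: vec_eq_iff axis_def)
    moreover have "w $ i - z $ i \<in> {-1, 1}"
      using le by auto
    ultimately show ?thesis
      by (auto intro!: image_eqI[of _ _ "(i, w $ i - z $ i)"])
  qed simp
next
  fix w assume "w \<in> ?R"
  then show "w \<in> nbhd z"
    by (auto simp: nbhd_def axis_def if_distrib[of abs] sum.delta cong: if_cong)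
qed

lemma finite_nbhd [simp]: "finite (nbhd z)"
  by (simp add: nbhd_eq)

lemma nbhd_nonempty [simp]: "nbhd z \<noteq> {}"
  by (simp add: nbhd_eq)

lemma card_nbhd: "card (nbhd (z :: int ^ 'd)) = 2 * CARD('d) + 1"
proof -
  have "inj_on (\<lambda>(i, s). z + axis i s) (UNIV \<times> {-1, 1})"
    by (auto simp: inj_on_def axis_eq_axis)
  moreover have "z \<notin> (\<lambda>(i, s). z + axis i s) ` (UNIV \<times> {-1, 1})"
    by (auto simp: axis_eq_0_iff)
  ultimately show ?thesis
    by (simp add: nbhd_eq card_image card_cartesian_product)
qed

text \<open>
  A configuration of finitely many particles is the multiset \<open>\<eta>\<close> of their sites, so that
  \<open>count \<eta> z\<close> is the number of particles at \<open>z\<close>. The law of the set of children of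
  one particle at \<open>z\<close>, with their sites, is \<open>offspring P z\<close>.
\<close>

definition offspring :: "nat pmf \<Rightarrow> int ^ 'd \<Rightarrow> (int ^ 'd) multiset pmf" where
  "offspring P z =
     bind_pmf P (\<lambda>k. map_pmf mset (replicate_pmf k (pmf_of_set (nbhd z))))"

text \<open>The pair \<open>(z, k)\<close> stands for the \<open>k\<close>-th of the particles located at \<open>z\<close>.\<close>

definition particles :: "(int ^ 'd) multiset \<Rightarrow> ((int ^ 'd) \<times> nat) set" where
  "particles \<eta> = (SIGMA z:set_mset \<eta>. {..<count \<eta> z})"

lemma finite_particles [simp]: "finite (particles \<eta>)"
  by (simp add: particles_def)

definition brw_step :: "nat pmf \<Rightarrow> (int ^ 'd) multiset \<Rightarrow> (int ^ 'd) multiset pmf" where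
  "brw_step P \<eta> =
     map_pmf (\<lambda>f. \<Sum>p\<in>particles \<eta>. f p)
       (Pi_pmf (particles \<eta>) {#} (\<lambda>(z, k). offspring P z))"

text \<open>
  \<open>\<beta>\<close>, defined on the probability space \<open>M\<close>, is the Markov chain with transition law
  \<open>brw_step P\<close> started from a single particle at \<open>x\<close>. The number of particles at site \<open>z\<close>
  at time \<open>t\<close> is \<open>count (\<beta> t \<omega>) z\<close>.
\<close>

definition branching_random_walk ::
  "nat pmf \<Rightarrow> int ^ 'd \<Rightarrow> 'a measure \<Rightarrow> (nat \<Rightarrow> 'a \<Rightarrow> (int ^ 'd) multiset) \<Rightarrow> bool" where
  "branching_random_walk P x M \<beta> \<longleftrightarrow>
     prob_space M \<and>
     (\<forall>t. \<beta> t \<in> measurable M (count_space UNIV)) \<and>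
     (AE \<omega> in M. \<beta> 0 \<omega> = {#x#}) \<and>
     (\<forall>t h. measure M {\<omega> \<in> space M. \<forall>s\<le>Suc t. \<beta> s \<omega> = h s} =
            measure M {\<omega> \<in> space M. \<forall>s\<le>t. \<beta> s \<omega> = h s} * pmf (brw_step P (h t)) (h (Suc t)))"

lemma countable_configs: "countable (UNIV :: (int ^ 'd) multiset set)"
proof -
  have "countable (range (mset :: (int ^ 'd) list \<Rightarrow> _))"
    by simp
  then show ?thesis
    by (simp add: surj_mset)
qed

text \<open>
  Such processes exist for all \<open>P\<close> and \<open>x\<close>: let the step from configuration \<open>\<eta>\<close> at time \<open>t\<close>
  be given by the coordinate \<open>(t, \<eta>)\<close> of a family of independent configurations.
\<close>

primrec driven_path :: "int ^ 'd \<Rightarrow> nat \<Rightarrow> (nat \<times> (int ^ 'd) multiset \<Rightarrow> (int ^ 'd) multiset) \<Rightarrow> (int ^ 'd) multiset" where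
  "driven_path x 0 \<omega> = {#x#}"
| "driven_path x (Suc t) \<omega> = \<omega> (t, driven_path x t \<omega>)"

lemma driven_path_measurable:
   "driven_path x t \<in> measurable (\<Pi>\<^sub>M p\<in>UNIV. measure_pmf (brw_step P (snd p))) (count_space UNIV)"
proof (induction t)
  case 0
  then show ?case by (simp add: driven_path.simps(1)[abs_def])
next
  case (Suc t)
  note [measurable] = Suc
  have "(\<lambda>\<omega>. \<omega> (t, \<eta>)) \<in> measurable (\<Pi>\<^sub>M p\<in>UNIV. measure_pmf (brw_step P (snd p))) (count_space UNIV)" for \<eta> :: "(int ^ 'd) multiset"
    using measurable_component_singleton[of "(t, \<eta>)" UNIV "\<lambda>p. measure_pmf (brw_step P (snd p))"]
    by simp
  then have "(\<lambda>\<omega>. \<omega> (t, driven_path x t \<omega>)) \<in>  measurable (\<Pi>\<^sub>M p\<in>UNIV. measure_pmf (brw_step P (snd p))) (count_space UNIV)"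
    by (rule measurable_compose_countable'[OF _ Suc countable_configs])
  then show ?case by simp
qed

lemma driven_path_eq: "h 0 = {#x#} \<Longrightarrow> (\<forall>s\<le>t. driven_path x s \<omega> = h s) \<longleftrightarrow> (\<forall>s<t. \<omega> (s, h s) = h (Suc s))"
  by (induction t) (auto simp: le_Suc_eq less_Suc_eq)

lemma branching_random_walk_exists:
  "branching_random_walk P (x :: int ^ 'd)
     (\<Pi>\<^sub>M p\<in>UNIV. measure_pmf (brw_step P (snd p))) (driven_path x)"
proof -
  let ?K = "\<lambda>p :: nat \<times> (int ^ 'd) multiset. measure_pmf (brw_step P (snd p))"
  interpret product_prob_space ?K UNIV
    by (simp add: product_prob_space_def product_sigma_finite_def product_prob_space_axioms_def
        prob_space_measure_pmf prob_space_imp_sigma_finite)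
  let ?M = "\<Pi>\<^sub>M p\<in>UNIV. ?K p"
  have prob: "measure ?M {\<omega> \<in> space ?M. \<forall>s\<le>t. driven_path x s \<omega> = h s}
      = (if h 0 = {#x#} then \<Prod>s<t. pmf (brw_step P (h s)) (h (Suc s)) else 0)" for t h
  proof (cases "h 0 = {#x#}")
    case True
    let ?J = "(\<lambda>s. (s, h s)) ` {..<t}"
    have inj: "inj_on (\<lambda>s. (s, h s)) {..<t}"
      by (auto simp: inj_on_def)
    have "{\<omega> \<in> space ?M. \<forall>s\<le>t. driven_path x s \<omega> = h s} =
        {\<omega> \<in> space ?M. \<forall>p\<in>?J. \<omega> p \<in> {h (Suc (fst p))}}"
      using driven_path_eq[where h = h and x = x and t = t, OF True] by auto
    also have "emeasure ?M \<dots> = (\<Prod>p\<in>?J. emeasure (?K p) {h (Suc (fst p))})"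
      by (rule emeasure_PiM_Collect) auto
    also have "\<dots> = (\<Prod>s<t. ennreal (pmf (brw_step P (h s)) (h (Suc s))))"
      by (simp add: prod.reindex[OF inj] emeasure_pmf_single)
    finally show ?thesis
      using True by (simp add: measure_def prod_ennreal prod_nonneg)
  next
    case False
    then have "{\<omega> \<in> space ?M. \<forall>s\<le>t. driven_path x s \<omega> = h s} = {}"
      by auto
    then show ?thesis
      by (simp only: False if_False measure_empty)
  qed
  show ?thesis
    unfolding branching_random_walk_def prob
    by (auto intro: P.prob_space_axioms driven_path_measurable)
qed

definition hitting_time :: "nat \<Rightarrow> (nat \<Rightarrow> 'a \<Rightarrow> (int ^ 'd) multiset) \<Rightarrow> 'a \<Rightarrow> enat" where
  "hitting_time n \<beta> \<omega> = Inf {enat t | t. \<exists>z\<in>box_boundary n. count (\<beta> t \<omega>) z \<ge> 1}"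

definition hitting_prob :: "nat \<Rightarrow> 'a measure \<Rightarrow> (nat \<Rightarrow> 'a \<Rightarrow> (int ^ 'd) multiset) \<Rightarrow> real" where
  "hitting_prob n M \<beta> = measure M {\<omega> \<in> space M. hitting_time n \<beta> \<omega> < \<infinity>}"

lemma hitting_time_le_iff: "hitting_time n \<beta> \<omega> \<le> enat k \<longleftrightarrow> (\<exists>t\<le>k. \<exists>z\<in>box_boundary n. count (\<beta> t \<omega>) z \<ge> 1)"
  (is "_ \<longleftrightarrow> ?R")
proof
  let ?A = "{enat t | t. \<exists>z\<in>box_boundary n. count (\<beta> t \<omega>) z \<ge> 1}"
  assume *: "hitting_time n \<beta> \<omega> \<le> enat k"
  then have ne: "?A \<noteq> {}"
    by (force simp: hitting_time_def Inf_enat_def)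
  then have "Inf ?A \<in> ?A"
    unfolding Inf_enat_def by (metis (no_types, lifting) LeastI ex_in_conv)
  then show ?R
    using * unfolding hitting_time_def by auto
next
  assume ?R
  then obtain t where "t \<le> k" "\<exists>z\<in>box_boundary n. count (\<beta> t \<omega>) z \<ge> 1" by blast
  then have "hitting_time n \<beta> \<omega> \<le> enat t"
    unfolding hitting_time_def by (intro Inf_lower) auto
  also have "\<dots> \<le> enat k" using \<open>t \<le> k\<close> by simp
  finally show "hitting_time n \<beta> \<omega> \<le> enat k" .
qed

lemma measurable_hitting_time:
  assumes "branching_random_walk P x M \<beta>"
  shows "(\<lambda>\<omega>. ereal_of_enat (hitting_time n \<beta> \<omega>)) \<in> borel_measurable M"
proof -
  have [measurable]: "\<beta> t \<in> measurable M (count_space UNIV)" for t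
    using assms by (simp add: branching_random_walk_def)
  have eq: "hitting_time n \<beta> \<omega> = (if \<exists>k. hitting_time n \<beta> \<omega> \<le> enat k 
       then enat (LEAST k. hitting_time n \<beta> \<omega> \<le> enat k) else \<infinity>)" for \<omega>
    by (cases "hitting_time n \<beta> \<omega>") (auto intro: Least_equality[symmetric])
  have "hitting_time n \<beta> \<in> measurable M (count_space UNIV)"
    by (subst eq[abs_def], unfold hitting_time_le_iff) measurable
  then show ?thesis
    by (rule measurable_compose) simp
qed

text \<open>
  Comparison of cumulative distribution functions; the random variables may be defined on
  different probability spaces and may take the value \<open>\<infinity>\<close>.
\<close>

definition stoch_le ::
  "'a measure \<Rightarrow> ('a \<Rightarrow> ereal) \<Rightarrow> 'b measure \<Rightarrow> ('b \<Rightarrow> ereal) \<Rightarrow> bool" where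
  "stoch_le M X N Y \<longleftrightarrow>
     (\<forall>s::real. measure M {\<omega> \<in> space M. X \<omega> \<le> ereal s} \<ge> measure N {\<omega> \<in> space N. Y \<omega> \<le> ereal s})"

end

theory Submission
  imports Defs
begin

text \<open>
  Let \<open>r\<^sub>k(z)\<close> be the probability that the walk started from one particle at \<open>z\<close> has no particle
  on \<open>\<partial>\<Lambda>\<^sub>n\<close> up to time \<open>k\<close>. Since the families of distinct particles are independent, conditioning
  on the first generation shows that, for \<open>z\<close> off the boundary, \<open>r\<^sub>k\<^sub>+\<^sub>1(z) = G(a\<^sub>k(z))\<close>, where \<open>G\<close>
  is the generating function of the offspring law and \<open>a\<^sub>k(z)\<close> is the average of \<open>r\<^sub>k\<close> over the
  \<open>2d+1\<close> sites next to \<open>z\<close>. The theorem thus becomes a statement on a deterministic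
  recursion: inside the box, \<open>r\<^sub>k\<close> is antimonotone on the nonnegative orthant.

  That statement is proved by induction on \<open>k\<close>, one unit step \<open>z \<rightarrow> z + e\<^sub>i\<close> with \<open>z\<^sub>i \<ge> 0\<close> at a time
  (\<open>avoid_prob_antimono_step\<close>). As \<open>G\<close> is monotone, it suffices to compare averages. In a
  direction \<open>j \<noteq> i\<close> the neighbours \<open>z \<plusminus> e\<^sub>j\<close> and \<open>z + e\<^sub>i \<plusminus> e\<^sub>j\<close> again differ by one step \<open>e\<^sub>i\<close>. On the
  line in direction \<open>i\<close> the two neighbourhoods are \<open>{z - e\<^sub>i, z, z + e\<^sub>i}\<close> and
  \<open>{z, z + e\<^sub>i, z + 2e\<^sub>i}\<close>; two sites are common, and \<open>z + 2e\<^sub>i\<close> must be compared with \<open>z - e\<^sub>i\<close>.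
  If \<open>z\<^sub>i \<ge> 1\<close>, three unit steps lead from the latter to the former; if \<open>z\<^sub>i = 0\<close>, the symmetry of
  \<open>r\<^sub>k\<close> under reflections (\<open>avoid_prob_reflect\<close>) replaces \<open>z - e\<^sub>i\<close> by \<open>z + e\<^sub>i\<close>. This cancellation
  relies on the parent's own site being one of the possible sites of its children: otherwise, for
  \<open>z\<^sub>i = 0\<close>, the site \<open>z + e\<^sub>i\<close> would have the neighbour \<open>z\<close>, which is better at avoiding the boundary
  than both \<open>z - e\<^sub>i\<close> and \<open>z + e\<^sub>i\<close>.

  The link with the process is \<open>measure_hitting_time_le\<close>: the law of a finite path is a product of
  transition probabilities, and the generating functional of one transition is a product over
  the particles (\<open>nn_integral_brw_step\<close>), so \<open>\<Prod>\<^bsub>z\<in>\<eta>\<^esub> r\<^sub>k(z)\<close> is the probability that the walk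
  started from the configuration \<open>\<eta>\<close> avoids the boundary up to time \<open>k\<close>.
\<close>

section \<open>Geometry of the box and of neighbourhoods\<close>

lemma sup_norm_le_iff: "sup_norm x \<le> c \<longleftrightarrow> (\<forall>i. \<bar>x $ i\<bar> \<le> c)"
  by (simp add: sup_norm_def)

lemma mem_lattice_box_iff: "x \<in> lattice_box n \<longleftrightarrow> (\<forall>i. \<bar>x $ i\<bar> \<le> int n)"
  by (simp add: lattice_box_def sup_norm_le_iff)

lemma mem_box_interior_iff: "x \<in> box_interior n \<longleftrightarrow> (\<forall>i. \<bar>x $ i\<bar> < int n)"
proof -
  have "x \<in> box_interior n \<longleftrightarrow> sup_norm x < int n"
    by (auto simp: box_interior_def box_boundary_def lattice_box_def)
  also have "\<dots> \<longleftrightarrow> (\<forall>i. \<bar>x $ i\<bar> < int n)"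
    by (simp add: sup_norm_def)
  finally show ?thesis .
qed

lemma box_boundary_iff: "x \<in> box_boundary n \<longleftrightarrow> x \<in> lattice_box n \<and> x \<notin> box_interior n"
  by (auto simp: box_interior_def box_boundary_def)

lemma sum_nbhd:
  fixes f :: "int ^ 'd \<Rightarrow> ennreal"
  shows "(\<Sum>w\<in>nbhd z. f w) = f z + (\<Sum>i\<in>UNIV. f (z + axis i 1) + f (z - axis i 1))"
proof -
  have ax: "axis i (-1 :: int) = - axis i 1" for i :: 'd
    by (simp add: vec_eq_iff axis_def)
  have inj: "inj_on (\<lambda>(i, s). z + axis i s) (UNIV \<times> {-1, 1})"
    by (auto simp: inj_on_def axis_eq_axis)
  have z: "z \<notin> (\<lambda>(i, s). z + axis i s) ` (UNIV \<times> {-1, 1})"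
    by (auto simp: axis_eq_0_iff)
  have "(\<Sum>w\<in>nbhd z. f w) = f z + (\<Sum>p\<in>UNIV \<times> {-1, 1}. f (case p of (i, s) \<Rightarrow> z + axis i s))"
    unfolding nbhd_eq using z by (simp add: sum.reindex[OF inj] o_def)
  also have "(\<Sum>p\<in>UNIV \<times> {-1, 1}. f (case p of (i, s) \<Rightarrow> z + axis i s)) =
      (\<Sum>i\<in>UNIV. \<Sum>s\<in>{-1, 1}. f (z + axis i s))"
    unfolding sum.cartesian_product by (simp only: split_def)
  also have "\<dots> = (\<Sum>i\<in>UNIV. f (z + axis i 1) + f (z - axis i 1))"
    by (simp add: ax add.commute)
  finally show ?thesis .
qed

definition reflect :: "'d \<Rightarrow> int ^ 'd \<Rightarrow> int ^ 'd" where
  "reflect i x = (\<chi> j. if j = i then - x $ j else x $ j)"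

lemma reflect_nth [simp]: "reflect i x $ j = (if j = i then - x $ j else x $ j)"
  by (simp add: reflect_def)

lemma reflect_reflect [simp]: "reflect i (reflect i x) = x"
  by (simp add: vec_eq_iff)

lemma reflect_mem_box_boundary [simp]: "reflect i x \<in> box_boundary n \<longleftrightarrow> x \<in> box_boundary n"
proof -
  have "\<bar>reflect i x $ j\<bar> = \<bar>x $ j\<bar>" for j by simp
  then show ?thesis
    unfolding box_boundary_iff mem_lattice_box_iff mem_box_interior_iff by presburger
qed

lemma nbhd_reflect:
  fixes z :: "int ^ 'd"
  shows "nbhd (reflect i z) = reflect i ` nbhd z"
proof -
  have iso: "reflect i w \<in> nbhd (reflect i z) \<longleftrightarrow> w \<in> nbhd z" for w z :: "int ^ 'd"
  proof -
    have "\<bar>reflect i w $ j - reflect i z $ j\<bar> = \<bar>w $ j - z $ j\<bar>" for j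
      by (cases "j = i") simp_all
    then show ?thesis by (simp only: nbhd_def mem_Collect_eq)
  qed
  show ?thesis
  proof (intro equalityI subsetI)
    fix w assume "w \<in> nbhd (reflect i z)"
    then have "reflect i w \<in> nbhd z" using iso[of "reflect i w" z] by simp
    then show "w \<in> reflect i ` nbhd z" by (intro image_eqI[of _ _ "reflect i w"]) simp_all
  qed (auto simp: iso)
qed

section \<open>Probability of avoiding the boundary, as a recursion\<close>

text \<open>
  The law of the walk does not enter here; \<open>emeasure_history_avoids_boundary\<close> shows that this is the
  probability that the name announces. With values in \<^typ>\<open>ennreal\<close>, the integrals that occur need no
  integrability conditions.
\<close>

primrec avoid_prob :: "nat pmf \<Rightarrow> nat \<Rightarrow> nat \<Rightarrow> int ^ 'd \<Rightarrow> ennreal" where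
  "avoid_prob P n 0 z = (if z \<in> box_boundary n then 0 else 1)"
| "avoid_prob P n (Suc k) z =
     (if z \<in> box_boundary n then 0
      else \<integral>\<^sup>+ m. ((\<Sum>w\<in>nbhd z. avoid_prob P n k w) / of_nat (card (nbhd z))) ^ m \<partial>measure_pmf P)"

text \<open>
  Reflection in a coordinate hyperplane preserves the boundary and maps neighbourhoods to
  neighbourhoods, hence it commutes with the recursion.
\<close>

lemma avoid_prob_reflect: "avoid_prob P n k (reflect i z) = avoid_prob P n k z"
proof (induction k arbitrary: z)
  case (Suc k)
  have "inj_on (reflect i) (nbhd z)"
    by (metis inj_on_inverseI reflect_reflect)
  then show ?case
    by (simp add: nbhd_reflect sum.reindex Suc card_nbhd card_image)
qed simp

text \<open>
  The heart of the argument. The sign condition concerns only the coordinate that is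
  increased; the others may become negative when the induction hypothesis is applied at
  \<open>z - e\<^sub>j\<close> for \<open>j \<noteq> i\<close>. The step has to stay in the box: from a boundary
  site, where the probability is \<open>0\<close>, a step outwards can increase it.
\<close>

lemma avoid_prob_antimono_step:
  fixes z :: "int ^ 'd"
  assumes "0 \<le> z $ i" "z + axis i 1 \<in> lattice_box n"
  shows "avoid_prob P n k (z + axis i 1) \<le> avoid_prob P n k z"
  using assms
proof (induction k arbitrary: z)
  case 0
  have le: "\<bar>z $ j\<bar> \<le> \<bar>(z + axis i 1) $ j\<bar>" for j
    using 0(1) by (cases "j = i") (simp_all add: axis_def)
  have "z \<in> box_interior n" if "z + axis i 1 \<in> box_interior n"
    unfolding mem_box_interior_iff
    using that[unfolded mem_box_interior_iff] le order_le_less_trans by blast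
  then show ?case
    using 0(2) by (auto simp: box_boundary_iff)
next
  case (Suc k)
  let ?e = "\<lambda>j. axis j 1 :: int ^ 'd" and ?r = "avoid_prob P n k"
  show ?case
  proof (cases "z + ?e i \<in> box_boundary n")
    case True
    then show ?thesis by simp
  next
    case False
    with Suc.prems have int: "\<bar>(z + ?e i) $ j\<bar> < int n" for j
      by (simp add: box_boundary_iff mem_box_interior_iff)
    have z_int: "\<bar>z $ j\<bar> < int n" for j
      using int[of j] Suc.prems(1) by (auto simp: axis_def split: if_splits)
    have nb: "\<bar>(z + ?e i + ?e j) $ l\<bar> \<le> int n" "\<bar>(z + ?e i - ?e j) $ l\<bar> \<le> int n" for j l
    proof -
      have "\<bar>?e j $ l\<bar> \<le> 1" by (simp add: axis_def)
      then show "\<bar>(z + ?e i + ?e j) $ l\<bar> \<le> int n" "\<bar>(z + ?e i - ?e j) $ l\<bar> \<le> int n"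
        using int[of l] unfolding vector_add_component vector_minus_component by arith+
    qed
    have box: "z + ?e i + ?e j \<in> lattice_box n" "z + ?e i - ?e j \<in> lattice_box n" for j
      unfolding mem_lattice_box_iff by (intro allI nb)+
    have step: "?r (w + ?e i) \<le> ?r w" if "0 \<le> w $ i" "w + ?e i \<in> lattice_box n" for w
      using Suc.IH that by blast
    \<comment> \<open>The sites of the two neighbourhoods on the line in direction \<open>i\<close> that are not shared.\<close>
    have zi: "?r (z + ?e i + ?e i) \<le> ?r (z - ?e i)"
    proof (cases "z $ i = 0")
      case True
      have "z - ?e i = reflect i (z + ?e i)"
        using True by (auto simp: vec_eq_iff axis_def)
      then have "?r (z - ?e i) = ?r (z + ?e i)" by (simp add: avoid_prob_reflect)
      then show ?thesis
        using step[of "z + ?e i"] Suc.prems(1) box(1)[of i] by (simp add: axis_def)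
    next
      case False
      then have pos: "0 \<le> (z - ?e i) $ i" using Suc.prems(1) by (simp add: axis_def)
      have "?r (z + ?e i + ?e i) \<le> ?r (z + ?e i)"
        using step[of "z + ?e i"] Suc.prems(1) box(1)[of i] by (simp add: axis_def)
      also have "\<dots> \<le> ?r z" using step[of z] Suc.prems by simp
      also have "\<dots> \<le> ?r (z - ?e i)"
        using step[OF pos] z_int by (simp add: mem_lattice_box_iff less_imp_le)
      finally show ?thesis .
    qed
    let ?S = "\<Sum>j\<in>UNIV - {i}. ?r (z + ?e j) + ?r (z - ?e j)"
      and ?S' = "\<Sum>j\<in>UNIV - {i}. ?r (z + ?e i + ?e j) + ?r (z + ?e i - ?e j)"
    have "?S' \<le> ?S"
    proof (intro sum_mono add_mono)
      fix j assume "j \<in> UNIV - {i}"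
      then have "0 \<le> (z + ?e j) $ i" "0 \<le> (z - ?e j) $ i"
        using Suc.prems(1) by (auto simp: axis_def)
      then show "?r (z + ?e i + ?e j) \<le> ?r (z + ?e j)" "?r (z + ?e i - ?e j) \<le> ?r (z - ?e j)"
        using step[of "z + ?e j"] step[of "z - ?e j"] box[of j] by (simp_all add: algebra_simps)
    qed
    with zi have "(?r (z + ?e i) + ?r z) + (?r (z + ?e i + ?e i) + ?S')
        \<le> (?r (z + ?e i) + ?r z) + (?r (z - ?e i) + ?S)"
      by (intro add_mono order_refl)
    \<comment> \<open>Both sums contain the shared sites \<open>z\<close> and \<open>z + e\<^sub>i\<close>.\<close>
    moreover have "(\<Sum>w\<in>nbhd (z + ?e i). ?r w)
        = (?r (z + ?e i) + ?r z) + (?r (z + ?e i + ?e i) + ?S')"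
      unfolding sum_nbhd sum.remove[OF finite UNIV_I, of _ i]
      by (simp only: add_diff_cancel_right' ac_simps)
    moreover have "(\<Sum>w\<in>nbhd z. ?r w) = (?r (z + ?e i) + ?r z) + (?r (z - ?e i) + ?S)"
      unfolding sum_nbhd sum.remove[OF finite UNIV_I, of _ i] by (simp only: ac_simps)
    ultimately have "(\<Sum>w\<in>nbhd (z + ?e i). ?r w) \<le> (\<Sum>w\<in>nbhd z. ?r w)"
      by (simp only:)
    moreover have "z \<notin> box_boundary n"
      using z_int by (simp add: box_boundary_iff mem_box_interior_iff)
    ultimately show ?thesis
      using False by (auto simp: card_nbhd intro!: nn_integral_mono power_mono divide_right_mono_ennreal)
  qed
qed

text \<open>
  The points \<open>x \<preceq> y\<close> are joined by unit steps, all of which lie between them and so in the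
  orthant and in the box.
\<close>

lemma avoid_prob_antimono:
  fixes x y :: "int ^ 'd"
  assumes "x \<in> nonneg_orthant" "y \<in> lattice_box n" "x \<le> y"
  shows "avoid_prob P n k y \<le> avoid_prob P n k x"
  using assms
proof (induction "nat (\<Sum>i\<in>UNIV. y $ i - x $ i)" arbitrary: x rule: less_induct)
  case less
  show ?case
  proof (cases "x = y")
    case False
    let ?x' = "\<lambda>i. x + axis i 1"
    obtain i where i: "x $ i < y $ i"
      using False less.prems(3) by (auto simp: vec_eq_iff less_eq_vec_def order_less_le)
    have le: "x $ j \<le> ?x' i $ j" "?x' i $ j \<le> y $ j" for j
      using i less.prems(3) by (auto simp: less_eq_vec_def axis_def)
    have x': "?x' i \<in> nonneg_orthant" "?x' i \<le> y" and x0: "0 \<le> x $ i"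
      using le less.prems(1) by (auto simp: nonneg_orthant_def less_eq_vec_def intro: order_trans)
    have "(\<Sum>j\<in>UNIV. y $ j - ?x' i $ j) < (\<Sum>j\<in>UNIV. y $ j - x $ j)"
      by (rule sum_strict_mono_ex1) (auto simp: axis_def)
    moreover have "0 \<le> (\<Sum>j\<in>UNIV. y $ j - ?x' i $ j)"
      using le by (intro sum_nonneg) simp
    ultimately have "avoid_prob P n k y \<le> avoid_prob P n k (?x' i)"
      using less.hyps x' less.prems(2) by simp
    also have "?x' i \<in> lattice_box n"
      unfolding mem_lattice_box_iff
    proof
      fix j
      show "\<bar>?x' i $ j\<bar> \<le> int n"
        using le(2)[of j] x'(1) less.prems(2)
        by (auto simp: nonneg_orthant_def mem_lattice_box_iff simp del: vector_add_component) (smt (verit))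
    qed
    then have "avoid_prob P n k (?x' i) \<le> avoid_prob P n k x"
      by (rule avoid_prob_antimono_step[of _ _ n, rotated]) (rule x0)
    finally show ?thesis .
  qed simp
qed

section \<open>Product form of the one-step transition\<close>

lemma prod_mset_sum:
  "finite A \<Longrightarrow> (\<Prod>z\<in>#(\<Sum>p\<in>A. f p). g z) = (\<Prod>p\<in>A. \<Prod>z\<in>#f p. g z)"
  by (induction A rule: finite_induct) auto

lemma nn_integral_prod_list_replicate_pmf:
  fixes f :: "'b \<Rightarrow> ennreal"
  shows "(\<integral>\<^sup>+ xs. prod_list (map f xs) \<partial>replicate_pmf m p) = (\<integral>\<^sup>+ x. f x \<partial>p) ^ m"
  by (induction m) (simp_all add: nn_integral_cmult nn_integral_multc)

text \<open>
  Given their number, the children choose their sites independently, so the generating functional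
  of a family is the generating function of \<open>P\<close> at the mean of \<open>f\<close> over the neighbourhood.
\<close>

lemma nn_integral_offspring:
  fixes f :: "int ^ 'd \<Rightarrow> ennreal"
  shows "(\<integral>\<^sup>+ \<eta>. (\<Prod>w\<in>#\<eta>. f w) \<partial>offspring P z)
     = (\<integral>\<^sup>+ m. ((\<Sum>w\<in>nbhd z. f w) / of_nat (card (nbhd z))) ^ m \<partial>P)"
proof -
  have "(\<Prod>w\<in>#mset xs. f w) = prod_list (map f xs)" for xs
    by (simp flip: prod_mset_prod_list)
  then show ?thesis
    by (simp add: offspring_def nn_integral_prod_list_replicate_pmf nn_integral_pmf_of_set)
qed

text \<open>The branching property: distinct particles have independent families.\<close>

lemma nn_integral_brw_step:
  fixes f :: "int ^ 'd \<Rightarrow> ennreal"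
  shows "(\<integral>\<^sup>+ \<eta>'. (\<Prod>w\<in>#\<eta>'. f w) \<partial>brw_step P \<eta>)
     = (\<Prod>z\<in>#\<eta>. \<integral>\<^sup>+ \<eta>'. (\<Prod>w\<in>#\<eta>'. f w) \<partial>offspring P z)"
proof -
  let ?c = "\<lambda>z. \<integral>\<^sup>+ \<eta>'. (\<Prod>w\<in>#\<eta>'. f w) \<partial>offspring P z"
  have "(\<integral>\<^sup>+ \<eta>'. (\<Prod>w\<in>#\<eta>'. f w) \<partial>brw_step P \<eta>) = (\<Prod>p\<in>particles \<eta>. ?c (fst p))"
    using nn_integral_prod_Pi_pmf[of "particles \<eta>" "{#}" "\<lambda>p. offspring P (fst p)"
        "\<lambda>_ \<eta>'. \<Prod>w\<in>#\<eta>'. f w"]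
    by (simp add: brw_step_def prod_mset_sum split_def)
  also have "\<dots> = (\<Prod>z\<in>set_mset \<eta>. \<Prod>k<count \<eta> z. ?c z)"
    unfolding particles_def by (subst prod.Sigma) (auto simp: split_def)
  finally show ?thesis
    by (simp add: image_prod_mset_multiplicity)
qed

definition avoids_boundary :: "nat \<Rightarrow> (int ^ 'd) multiset \<Rightarrow> bool" where
  "avoids_boundary n \<eta> \<longleftrightarrow> (\<forall>z\<in>#\<eta>. z \<notin> box_boundary n)"

lemma prod_avoid_prob_0:
  "(\<Prod>z\<in>#\<eta>. avoid_prob P n 0 z) = (if avoids_boundary n \<eta> then 1 else 0)"
  by (induction \<eta>) (auto simp: avoids_boundary_def)

lemma prod_avoid_prob_eq_0:
  assumes "\<not> avoids_boundary n \<eta>"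
  shows "(\<Prod>z\<in>#\<eta>. avoid_prob P n k z) = 0"
proof -
  obtain z where "z \<in># \<eta>" "z \<in> box_boundary n"
    using assms by (auto simp: avoids_boundary_def)
  moreover from this have "avoid_prob P n k z = 0" by (cases k) simp_all
  ultimately show ?thesis
    by (metis image_mset_add_mset mult_zero_left multi_member_split prod_mset.add_mset)
qed

text \<open>
  The backward equation for the chain of configurations, which identifies the product of
  \<^const>\<open>avoid_prob\<close> over the particles as a probability of avoidance.
\<close>

lemma prod_avoid_prob_Suc:
  assumes "avoids_boundary n \<eta>"
  shows "(\<Prod>z\<in>#\<eta>. avoid_prob P n (Suc k) z)
    = (\<integral>\<^sup>+ \<eta>'. (\<Prod>z\<in>#\<eta>'. avoid_prob P n k z) \<partial>brw_step P \<eta>)"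
  using assms unfolding nn_integral_brw_step nn_integral_offspring
  by (auto simp: avoids_boundary_def intro!: arg_cong[of _ _ prod_mset] image_mset_cong)

section \<open>Law of the path up to a fixed time\<close>

text \<open>
  The most recent configuration comes first, so that a step of the chain is a \<open>Cons\<close>.
\<close>

primrec history :: "nat pmf \<Rightarrow> int ^ 'd \<Rightarrow> nat \<Rightarrow> (int ^ 'd) multiset list pmf" where
  "history P x 0 = return_pmf [{#x#}]"
| "history P x (Suc t) = bind_pmf (history P x t) (\<lambda>hs. map_pmf (\<lambda>\<eta>. \<eta> # hs) (brw_step P (hd hs)))"

lemma history_nonempty: "hs \<in> set_pmf (history P x t) \<Longrightarrow> hs \<noteq> []"
  by (cases t) auto

lemma pmf_history_Suc:
  "pmf (history P x (Suc t)) (\<eta> # hs) = pmf (history P x t) hs * pmf (brw_step P (hd hs)) \<eta>"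
proof -
  have *: "pmf (map_pmf (\<lambda>\<eta>. \<eta> # hs') (brw_step P (hd hs'))) (\<eta> # hs)
      = indicator {hs} hs' * pmf (brw_step P (hd hs)) \<eta>" for hs'
  proof (cases "hs' = hs")
    case True
    have "inj (\<lambda>\<eta>. \<eta> # hs)" by (simp add: inj_def)
    then have "pmf (map_pmf (\<lambda>\<eta>. \<eta> # hs) (brw_step P (hd hs))) (\<eta> # hs) = pmf (brw_step P (hd hs)) \<eta>"
      by (rule pmf_map_inj')
    then show ?thesis using True by simp
  next
    case False
    then show ?thesis by (auto simp: pmf_eq_0_set_pmf)
  qed
  show ?thesis
    unfolding history.simps pmf_bind * by (simp add: measure_pmf_single)
qed

definition path_history :: "(nat \<Rightarrow> 'a \<Rightarrow> 'c) \<Rightarrow> nat \<Rightarrow> 'a \<Rightarrow> 'c list" where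
  "path_history \<beta> t \<omega> = map (\<lambda>s. \<beta> s \<omega>) (rev [0..<Suc t])"

lemma path_history_Suc: "path_history \<beta> (Suc t) \<omega> = \<beta> (Suc t) \<omega> # path_history \<beta> t \<omega>"
  by (simp add: path_history_def)

text \<open>
  The Markov property is given for cylinder events \<open>\<forall>s\<le>t. \<beta> s \<omega> = h s\<close>. A list of length
  \<open>Suc t\<close> is the history of such a function \<open>h\<close>, and a list of any other length has probability zero
  on both sides.
\<close>

lemma measure_path_history:
  assumes "branching_random_walk P x M \<beta>"
  shows "measure M {\<omega> \<in> space M. path_history \<beta> t \<omega> = hs} = pmf (history P x t) hs"
proof (induction t arbitrary: hs)
  case 0
  interpret prob_space M using assms by (simp add: branching_random_walk_def)
  have [measurable]: "\<beta> t \<in> measurable M (count_space UNIV)" for t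
    using assms by (simp add: branching_random_walk_def)
  have ae: "AE \<omega> in M. \<beta> 0 \<omega> = {#x#}"
    using assms by (simp add: branching_random_walk_def)
  have "prob {\<omega> \<in> space M. [\<beta> 0 \<omega>] = hs} = prob {\<omega> \<in> space M. [{#x#}] = hs}"
  proof (rule finite_measure_eq_AE)
    have "{\<omega> \<in> space M. [\<beta> 0 \<omega>] = hs} = {\<omega> \<in> space M. hs \<noteq> [] \<and> tl hs = [] \<and> \<beta> 0 \<omega> = hd hs}"
      by (cases hs) auto
    also have "\<dots> \<in> events" by measurable
    finally show "{\<omega> \<in> space M. [\<beta> 0 \<omega>] = hs} \<in> events" .
  qed (use ae in auto)
  then show ?case
    by (cases "hs = [{#x#}]") (auto simp: path_history_def prob_space indicator_def)
next
  case (Suc t)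
  have markov: "measure M {\<omega> \<in> space M. \<forall>s\<le>Suc t. \<beta> s \<omega> = h s} =
       measure M {\<omega> \<in> space M. \<forall>s\<le>t. \<beta> s \<omega> = h s} * pmf (brw_step P (h t)) (h (Suc t))" for h
    using assms by (simp add: branching_random_walk_def)
  have eq: "path_history \<beta> t \<omega> = map h (rev [0..<Suc t]) \<longleftrightarrow> (\<forall>s\<le>t. \<beta> s \<omega> = h s)" for h t \<omega>
    unfolding path_history_def map_eq_conv by (auto simp del: upt_Suc simp: less_Suc_eq_le)
  show ?case
  proof (cases hs)
    case Nil
    then show ?thesis
      using history_nonempty[of "[]" P x "Suc t"] by (auto simp: path_history_Suc pmf_eq_0_set_pmf simp del: history.simps)
  next
    case (Cons \<eta> g)
    show ?thesis
    proof (cases "length g = Suc t")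
      case False
      then have ne: "path_history \<beta> t \<omega> \<noteq> g" for \<omega>
        by (auto simp: path_history_def)
      have "pmf (history P x t) g = 0"
        using ne by (simp flip: Suc)
      then show ?thesis
        using ne by (simp add: Cons path_history_Suc pmf_history_Suc del: history.simps)
    next
      case True
      define h where "h s = (if s \<le> t then g ! (t - s) else \<eta>)" for s
      have g: "g = map h (rev [0..<Suc t])"
        using True by (intro nth_equalityI) (auto simp: rev_nth h_def simp del: upt_Suc)
      have hs: "hs = map h (rev [0..<Suc (Suc t)])"
        unfolding Cons g by (simp add: h_def)
      have "measure M {\<omega> \<in> space M. path_history \<beta> (Suc t) \<omega> = hs}
          = pmf (history P x t) g * pmf (brw_step P (h t)) (h (Suc t))"
        unfolding hs eq markov by (simp only: g flip: Suc eq)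
      also have "h t = hd g" by (simp add: g)
      also have "h (Suc t) = \<eta>" by (simp add: h_def)
      finally show ?thesis
        by (simp add: Cons pmf_history_Suc del: history.simps)
    qed
  qed
qed

text \<open>
  There are only countably many histories, so their law is determined by its point masses.
\<close>

lemma distr_path_history:
  assumes "branching_random_walk P (x :: int ^ 'd) M \<beta>"
  shows "path_history \<beta> t \<in> measurable M (count_space UNIV)"
    and "distr M (count_space UNIV) (path_history \<beta> t) = measure_pmf (history P x t)"
proof -
  interpret prob_space M using assms by (simp add: branching_random_walk_def)
  have countable: "countable (UNIV :: (int ^ 'd) multiset list set)"
    using countable_lists[OF countable_configs] by (simp add: lists_UNIV)
  have [measurable]: "\<beta> t \<in> measurable M (count_space UNIV)" for t
    using assms by (simp add: branching_random_walk_def)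
  have sing: "path_history \<beta> t -` {hs} \<inter> space M \<in> sets M" for hs
  proof (cases "length hs = Suc t")
    case True
    then have "path_history \<beta> t -` {hs} \<inter> space M = {\<omega> \<in> space M. \<forall>i<Suc t. \<beta> (t - i) \<omega> = hs ! i}"
      by (auto simp: path_history_def list_eq_iff_nth_eq rev_nth simp del: upt_Suc)
    then show ?thesis by simp
  next
    case False
    then have "path_history \<beta> t -` {hs} \<inter> space M = {}"
      by (auto simp: path_history_def)
    then show ?thesis by (simp only: sets.empty_sets)
  qed
  then show meas: "path_history \<beta> t \<in> measurable M (count_space UNIV)"
    by (subst measurable_count_space_eq_countable[OF countable]) auto
  show "distr M (count_space UNIV) (path_history \<beta> t) = measure_pmf (history P x t)"
  proof (rule measure_eqI_countable[OF _ _ countable])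
    fix hs
    have "path_history \<beta> t -` {hs} \<inter> space M = {\<omega> \<in> space M. path_history \<beta> t \<omega> = hs}" by auto
    then show "emeasure (distr M (count_space UNIV) (path_history \<beta> t)) {hs}
        = emeasure (measure_pmf (history P x t)) {hs}"
      by (simp add: emeasure_distr[OF meas] emeasure_eq_measure measure_path_history[OF assms] emeasure_pmf_single)
  qed auto
qed

section \<open>Law of the hitting time\<close>

text \<open>
  The expectation of \<open>\<Prod>z. avoid_prob P n k z\<close> over the particles present at time \<open>t\<close>, on the event
  that the boundary was avoided up to time \<open>t\<close>, depends on \<open>t + k\<close> only: by the backward equation, one
  more step of the path is worth one step of the recursion. For \<open>k = 0\<close> it is the
  probability of avoidance up to time \<open>t\<close>, for \<open>t = 0\<close> it is the value of the recursion at \<open>x\<close>.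
\<close>

lemma emeasure_history_avoids_boundary:
  "emeasure (history P x k) {hs. \<forall>\<eta>\<in>set hs. avoids_boundary n \<eta>} = avoid_prob P n k x"
proof -
  let ?\<Phi> = "\<lambda>k \<eta>. \<Prod>z\<in>#\<eta>. avoid_prob P n k z"
  let ?A = "{hs. \<forall>\<eta>\<in>set hs. avoids_boundary n \<eta>}"
  let ?J = "\<lambda>t k. \<integral>\<^sup>+ hs. indicator ?A hs * ?\<Phi> k (hd hs) \<partial>history P x t"
  have shift: "?J (Suc t) k = ?J t (Suc k)" for t k
  proof -
    have "?J (Suc t) k = (\<integral>\<^sup>+ hs. \<integral>\<^sup>+ \<eta>. indicator ?A (\<eta> # hs) * ?\<Phi> k \<eta> \<partial>brw_step P (hd hs) \<partial>history P x t)"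
      by simp
    also have "\<dots> = (\<integral>\<^sup>+ hs. \<integral>\<^sup>+ \<eta>. indicator ?A hs * ?\<Phi> k \<eta> \<partial>brw_step P (hd hs) \<partial>history P x t)"
      by (intro nn_integral_cong) (auto simp: indicator_def prod_avoid_prob_eq_0)
    also have "\<dots> = (\<integral>\<^sup>+ hs. indicator ?A hs * (\<integral>\<^sup>+ \<eta>. ?\<Phi> k \<eta> \<partial>brw_step P (hd hs)) \<partial>history P x t)"
      by (simp add: nn_integral_cmult)
    also have "\<dots> = ?J t (Suc k)"
    proof (intro nn_integral_cong_AE AE_pmfI)
      fix hs assume "hs \<in> set_pmf (history P x t)"
      then have "hd hs \<in> set hs" using history_nonempty by force
      then show "indicator ?A hs * (\<integral>\<^sup>+ \<eta>. ?\<Phi> k \<eta> \<partial>brw_step P (hd hs)) = indicator ?A hs * ?\<Phi> (Suc k) (hd hs)"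
        by (cases "hs \<in> ?A") (auto simp: prod_avoid_prob_Suc simp del: avoid_prob.simps)
    qed
    finally show ?thesis .
  qed
  have "?J k 0 = ?J 0 k"
  proof -
    have "?J (k - j) j = ?J k 0" if "j \<le> k" for j
      using that
    proof (induction j)
      case (Suc j)
      then have "k - j = Suc (k - Suc j)" by simp
      then show ?case using Suc shift[of "k - Suc j" j] by (simp del: history.simps avoid_prob.simps)
    qed simp
    from this[of k] show ?thesis by simp
  qed
  also have "?J 0 k = avoid_prob P n k x"
    using prod_avoid_prob_eq_0[of n "{#x#}" P k] by (auto simp: indicator_def)
  also have "?J k 0 = (\<integral>\<^sup>+ hs. indicator ?A hs \<partial>history P x k)"
  proof (intro nn_integral_cong_AE AE_pmfI)
    fix hs assume "hs \<in> set_pmf (history P x k)"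
    then have "hd hs \<in> set hs" using history_nonempty by force
    then show "indicator ?A hs * ?\<Phi> 0 (hd hs) = indicator ?A hs"
      by (cases "hs \<in> ?A") (auto simp: prod_avoid_prob_0 simp del: avoid_prob.simps)
  qed
  also have "\<dots> = emeasure (history P x k) ?A" by simp
  finally show ?thesis .
qed

lemma hitting_time_le_iff_path_history:
  "hitting_time n \<beta> \<omega> \<le> enat k \<longleftrightarrow> \<not> (\<forall>\<eta>\<in>set (path_history \<beta> k \<omega>). avoids_boundary n \<eta>)"
  unfolding hitting_time_le_iff path_history_def avoids_boundary_def
  by (auto simp: less_Suc_eq_le Suc_le_eq simp del: upt_Suc)

lemma sets_hitting_time_le:
  assumes "branching_random_walk P x M \<beta>"
  shows "{\<omega> \<in> space M. hitting_time n \<beta> \<omega> \<le> enat k} \<in> sets M"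
proof -
  have [measurable]: "\<beta> t \<in> measurable M (count_space UNIV)" for t
    using assms by (simp add: branching_random_walk_def)
  show ?thesis
    unfolding hitting_time_le_iff by measurable
qed

lemma measure_hitting_time_le:
  assumes "branching_random_walk P x M \<beta>"
  shows "ennreal (measure M {\<omega> \<in> space M. hitting_time n \<beta> \<omega> \<le> enat k}) = 1 - avoid_prob P n k x"
proof -
  interpret prob_space M using assms by (simp add: branching_random_walk_def)
  let ?A = "{hs. \<forall>\<eta>\<in>set hs. avoids_boundary n \<eta>}"
  have "emeasure M {\<omega> \<in> space M. hitting_time n \<beta> \<omega> \<le> enat k}
      = emeasure (distr M (count_space UNIV) (path_history \<beta> k)) (- ?A)"
    unfolding hitting_time_le_iff_path_history
    by (subst emeasure_distr[OF distr_path_history(1)[OF assms]]) (auto intro!: arg_cong2[where f = emeasure])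
  also have "\<dots> = 1 - emeasure (history P x k) ?A"
    unfolding distr_path_history(2)[OF assms]
    using emeasure_compl[of ?A "measure_pmf (history P x k)"]
    by (simp add: Compl_eq_Diff_UNIV measure_pmf.emeasure_space_1[simplified])
  finally show ?thesis
    by (simp add: emeasure_history_avoids_boundary emeasure_eq_measure)
qed

text \<open>
  Being a limit of values of the distribution function, the hitting probability inherits the
  comparison.
\<close>

lemma hitting_prob_limit:
  assumes "branching_random_walk P x M \<beta>"
  shows "(\<lambda>k. measure M {\<omega> \<in> space M. hitting_time n \<beta> \<omega> \<le> enat k}) \<longlonglongrightarrow> hitting_prob n M \<beta>"
proof -
  interpret prob_space M using assms by (simp add: branching_random_walk_def)
  let ?E = "\<lambda>k. {\<omega> \<in> space M. hitting_time n \<beta> \<omega> \<le> enat k}"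
  have "incseq ?E" by (auto simp: incseq_def intro: order_trans)
  then have "(\<lambda>k. prob (?E k)) \<longlonglongrightarrow> prob (\<Union>k. ?E k)"
    using sets_hitting_time_le[OF assms] by (intro finite_Lim_measure_incseq) auto
  also have "(\<Union>k. ?E k) = {\<omega> \<in> space M. hitting_time n \<beta> \<omega> < \<infinity>}"
  proof -
    have "h < \<infinity> \<longleftrightarrow> (\<exists>k. h \<le> enat k)" for h by (cases h) auto
    then show ?thesis by auto
  qed
  finally show ?thesis by (simp add: hitting_prob_def)
qed

theorem theorem1:
  fixes P :: "nat pmf" and n :: nat and x y :: "int ^ 'd"
    and M :: "'a measure" and \<beta>x :: "nat \<Rightarrow> 'a \<Rightarrow> (int ^ 'd) multiset"
    and N :: "'b measure" and \<beta>y :: "nat \<Rightarrow> 'b \<Rightarrow> (int ^ 'd) multiset"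
  assumes "branching_random_walk P x M \<beta>x"
    and "branching_random_walk P y N \<beta>y"
    and "n \<ge> 1"
    and "x \<in> nonneg_orthant \<inter> box_interior n"
    and "y \<in> nonneg_orthant \<inter> box_interior n"
    and "x \<le> y"
  shows "stoch_le N (\<lambda>\<omega>. ereal_of_enat (hitting_time n \<beta>y \<omega>))
                  M (\<lambda>\<omega>. ereal_of_enat (hitting_time n \<beta>x \<omega>))
         \<and> hitting_prob n M \<beta>x \<le> hitting_prob n N \<beta>y"
proof -
  interpret M: prob_space M using assms(1) by (simp add: branching_random_walk_def)
  interpret N: prob_space N using assms(2) by (simp add: branching_random_walk_def)
  let ?F = "\<lambda>k. measure M {\<omega> \<in> space M. hitting_time n \<beta>x \<omega> \<le> enat k}"
    and ?G = "\<lambda>k. measure N {\<omega> \<in> space N. hitting_time n \<beta>y \<omega> \<le> enat k}"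
  have le: "?F k \<le> ?G k" for k
  proof -
    have "avoid_prob P n k y \<le> avoid_prob P n k x"
      using assms(4-6) by (intro avoid_prob_antimono) (auto simp: box_interior_def)
    then have "ennreal (?F k) \<le> ennreal (?G k)"
      unfolding measure_hitting_time_le[OF assms(1)] measure_hitting_time_le[OF assms(2)]
      by (rule ennreal_minus_mono[OF order_refl])
    then show ?thesis by (simp add: ennreal_le_iff)
  qed
  \<comment> \<open>Hitting times are integers or infinite, so integer thresholds suffice; for \<open>s < 0\<close> both events are empty.\<close>
  have floor: "ereal_of_enat h \<le> ereal s \<longleftrightarrow> 0 \<le> s \<and> h \<le> enat (nat \<lfloor>s\<rfloor>)" for h s
    by (cases h) (auto simp: le_nat_iff le_floor_iff nat_le_iff)
  have "measure M {\<omega> \<in> space M. ereal_of_enat (hitting_time n \<beta>x \<omega>) \<le> ereal s}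
      \<le> measure N {\<omega> \<in> space N. ereal_of_enat (hitting_time n \<beta>y \<omega>) \<le> ereal s}" for s
    unfolding floor using le by (cases "0 \<le> s") simp_all
  then have "stoch_le N (\<lambda>\<omega>. ereal_of_enat (hitting_time n \<beta>y \<omega>))
      M (\<lambda>\<omega>. ereal_of_enat (hitting_time n \<beta>x \<omega>))"
    by (simp add: stoch_le_def)
  moreover have "hitting_prob n M \<beta>x \<le> hitting_prob n N \<beta>y"
    using le hitting_prob_limit[OF assms(1), of n] hitting_prob_limit[OF assms(2), of n]
    by (intro LIMSEQ_le) auto
  ultimately show ?thesis by blast
qed

end
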